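(* Let $N$ be a positive integer, $\delta>0$, $0\le\mu<N-2$ and $\alpha\ge\frac{N-2-\mu}{N-2}$. There exists a constant $C(N,\alpha,\delta,\mu)>0$, depending only on $N,\alpha,\delta,\mu$, such that for all smooth functions $v:\mathbb{R}^N\to\mathbb{R}$, $$\int_{\mathbb{R}^N}\frac{|\nabla v(y)|^2}{|y|^{\mu}}e^{-\delta|y|^\alpha}dy\ \ge\ C(N,\alpha,\delta,\mu)\inf_{c\in\mathbb{R}}\int_{\mathbb{R}^N}\frac{|v(y)-c|^2}{|y|^{\frac{N\mu}{N-2}}}e^{-\delta|y|^\alpha}dy.$$
   Context: The inequality is understood in $[0,\infty]$ (it is trivial if the left-hand side is infinite). *)

theory Defs
  imports "HOL-Analysis.Analysis"
begin

definition partial_deriv :: "'n \<Rightarrow> (real ^ 'n \<Rightarrow> real) \<Rightarrow> real ^ 'n \<Rightarrow> real"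
  where "partial_deriv i f x = frechet_derivative f (at x) (axis i 1)"

definition grad :: "(real ^ 'n \<Rightarrow> real) \<Rightarrow> real ^ 'n \<Rightarrow> real ^ 'n"
  where "grad f x = (\<chi> i. partial_deriv i f x)"

lemma grad_GDERIV:
  fixes f :: "real ^ 'n \<Rightarrow> real"
  assumes "f differentiable (at x)"
  shows "GDERIV f x :> grad f x"
proof -
  let ?D = "frechet_derivative f (at x)"
  have D: "(f has_derivative ?D) (at x)"
    using assms frechet_derivative_works by blast
  then have lin: "linear ?D"
    by (rule has_derivative_linear)
  have "?D h = inner h (grad f x)" for h
  proof -
    have "?D h = ?D (\<Sum>i\<in>UNIV. h $ i *\<^sub>R axis i 1)"
      using basis_expansion[of h] by (simp add: scalar_mult_eq_scaleR)
    also have "\<dots> = (\<Sum>i\<in>UNIV. h $ i * ?D (axis i 1))"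
      by (simp add: linear_sum[OF lin] linear_scale[OF lin])
    finally show ?thesis
      by (simp add: inner_vec_def grad_def partial_deriv_def)
  qed
  then have "?D = (\<lambda>h. inner h (grad f x))"
    by (rule ext)
  with D show ?thesis
    by (simp add: gderiv_def)
qed

text \<open>Functions of class \<open>C\<^sup>k\<close> on the whole space. Differentiability is required
  explicitly because \<^const>\<open>frechet_derivative\<close> is total, with an unspecified value at
  points where the function is not differentiable.\<close>

fun C_k :: "nat \<Rightarrow> (real ^ 'n \<Rightarrow> real) \<Rightarrow> bool"
  where
    "C_k 0 f \<longleftrightarrow> continuous_on UNIV f"
  | "C_k (Suc k) f \<longleftrightarrow> (\<forall>x. f differentiable (at x)) \<and> (\<forall>i. C_k k (partial_deriv i f))"

definition smooth :: "(real ^ 'n \<Rightarrow> real) \<Rightarrow> bool"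
  where "smooth f \<longleftrightarrow> (\<forall>k. C_k k f)"

end

theory Submission
  imports Defs
begin

text \<open>Along a ray, integrating the derivative of \<open>u\<^sup>2 M\<close> for a function \<open>M\<close> that decreases at
  rate at least \<open>c p\<close> and satisfies \<open>M\<^sup>2 \<le> K p q\<close> bounds \<open>\<integral> u\<^sup>2 p\<close> by \<open>\<integral> u'\<^sup>2 q\<close>. With \<open>p\<close> and \<open>q\<close> the
  radial densities of the two weights, \<open>M = - r\<^bsup>m + 1\<^esup>\<close> works near the origin and
  \<open>M = r\<^bsup>m + 1 - \<alpha>\<^esup> exp (- \<delta> r\<^bsup>\<alpha>\<^esup>)\<close> works for \<open>r \<ge> R\<close>; the latter is where the lower bound on \<open>\<alpha>\<close>
  enters. Taking \<open>u = v - v (t \<omega>)\<close> on the ray through \<open>\<omega>\<close> and averaging over \<open>t \<in> [R, 2 R]\<close> reduces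
  the claim to an estimate of \<open>\<integral> (v - c)\<^sup>2\<close> over the ball of radius \<open>2 R\<close>. Averaging this over
  \<open>c = v y\<close> with \<open>y\<close> in the same ball leaves an unweighted double integral, which is bounded by
  joining the two points by a segment; there the gradient weight is bounded below.\<close>

section \<open>Weighted inequalities on intervals of the half-line\<close>

lemma integral_weighted_sq_le:
  fixes u u' M M' p q :: "real \<Rightarrow> real"
  assumes ab: "a \<le> b" and c: "c > 0"
    and du: "\<And>r. r \<in> {a..b} \<Longrightarrow> (u has_real_derivative u' r) (at r)"
    and dM: "\<And>r. r \<in> {a..b} \<Longrightarrow> (M has_real_derivative M' r) (at r)"
    and cont: "continuous_on {a..b} u'" "continuous_on {a..b} p" "continuous_on {a..b} q"
    and p0: "\<And>r. r \<in> {a..b} \<Longrightarrow> 0 \<le> p r" and q0: "\<And>r. r \<in> {a..b} \<Longrightarrow> 0 \<le> q r"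
    and M'_le: "\<And>r. r \<in> {a..b} \<Longrightarrow> M' r \<le> - c * p r"
    and M_le: "\<And>r. r \<in> {a..b} \<Longrightarrow> (M r)\<^sup>2 \<le> K * (p r * q r)"
    and K: "K \<ge> 0"
    and ends: "(u a)\<^sup>2 * M a \<le> (u b)\<^sup>2 * M b"
  shows "(\<integral>\<^sup>+ r\<in>{a..b}. ennreal ((u r)\<^sup>2 * p r) \<partial>lborel)
    \<le> ennreal (4 * K / c\<^sup>2) * (\<integral>\<^sup>+ r\<in>{a..b}. ennreal ((u' r)\<^sup>2 * q r) \<partial>lborel)"
proof -
  define F where "F = (\<lambda>r. 2 * u r * u' r * M r + (u r)\<^sup>2 * M' r)"
  have contu: "continuous_on {a..b} u"
    by (intro continuous_at_imp_continuous_on ballI DERIV_isCont[OF du])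
  have F: "(F has_integral ((u b)\<^sup>2 * M b - (u a)\<^sup>2 * M a)) {a..b}"
  proof (rule fundamental_theorem_of_calculus[OF ab])
    fix r assume r: "r \<in> {a..b}"
    have "((\<lambda>r. (u r)\<^sup>2 * M r) has_real_derivative F r) (at r)"
      unfolding F_def by (rule derivative_eq_intros du[OF r] dM[OF r] refl | simp)+ 
    then show "((\<lambda>r. (u r)\<^sup>2 * M r) has_vector_derivative F r) (at r within {a..b})"
      by (simp add: has_real_derivative_iff_has_vector_derivative has_vector_derivative_at_within)
  qed
  define I where "I = integral {a..b} (\<lambda>r. (u r)\<^sup>2 * p r)"
  define J where "J = integral {a..b} (\<lambda>r. (u' r)\<^sup>2 * q r)"
  have I: "((\<lambda>r. (u r)\<^sup>2 * p r) has_integral I) {a..b}" unfolding I_def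
    by (intro integrable_integral integrable_continuous_interval continuous_intros cont contu)
  have J: "((\<lambda>r. (u' r)\<^sup>2 * q r) has_integral J) {a..b}" unfolding J_def
    by (intro integrable_integral integrable_continuous_interval continuous_intros cont contu)
  \<comment> \<open>The cross term \<open>2 * u r * u' r * M r\<close> is at most
    \<open>2 * (A * B)\<close>, where \<open>A\<^sup>2 = (u r)\<^sup>2 * p r\<close> and
    \<open>B\<^sup>2 = K * ((u' r)\<^sup>2 * q r)\<close>. Young's inequality with weight
    \<open>c\<close> splits this product so that only half of the negative term
    \<open>- c * ((u r)\<^sup>2 * p r)\<close> is spent.\<close>
  have le: "F r \<le> - (c / 2) * ((u r)\<^sup>2 * p r) + (2 * K / c) * ((u' r)\<^sup>2 * q r)" if r: "r \<in> {a..b}" for r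
  proof -
    define A where "A = \<bar>u r\<bar> * sqrt (p r)"
    define B where "B = \<bar>u' r\<bar> * sqrt (K * q r)"
    have "\<bar>M r\<bar> \<le> sqrt (K * (p r * q r))"
      using M_le[OF r] by (simp add: real_le_rsqrt)
    also have "\<dots> = sqrt (p r) * sqrt (K * q r)"
      by (simp add: real_sqrt_mult)
    finally have "\<bar>u r\<bar> * \<bar>u' r\<bar> * \<bar>M r\<bar> \<le> \<bar>u r\<bar> * \<bar>u' r\<bar> * (sqrt (p r) * sqrt (K * q r))"
      by (intro mult_left_mono) auto
    moreover have "u r * u' r * M r \<le> \<bar>u r\<bar> * \<bar>u' r\<bar> * \<bar>M r\<bar>"
      by (metis abs_ge_self abs_mult)
    ultimately have 1: "u r * u' r * M r \<le> A * B"
      unfolding A_def B_def by (simp add: mult_ac)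
    have "0 \<le> (c * A - 2 * B)\<^sup>2 / (2 * c)" using c by simp
    also have "\<dots> = c / 2 * A\<^sup>2 + 2 / c * B\<^sup>2 - 2 * (A * B)"
      using c by (simp add: field_simps power2_eq_square)
    finally have 2: "2 * (A * B) \<le> c / 2 * A\<^sup>2 + 2 / c * B\<^sup>2" by simp
    have A: "A\<^sup>2 = (u r)\<^sup>2 * p r" using p0[OF r] by (simp add: A_def power_mult_distrib)
    have B: "B\<^sup>2 = K * ((u' r)\<^sup>2 * q r)" using q0[OF r] K by (simp add: B_def power_mult_distrib)
    have "(u r)\<^sup>2 * M' r \<le> (u r)\<^sup>2 * (- c * p r)" by (intro mult_left_mono M'_le r) auto
    then show ?thesis using 1 2 unfolding A B F_def by (simp add: algebra_simps)
  qed
  have "(u b)\<^sup>2 * M b - (u a)\<^sup>2 * M a \<le> - (c / 2) * I + (2 * K / c) * J"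
    by (rule has_integral_le[OF F has_integral_add[OF has_integral_mult_right[OF I] has_integral_mult_right[OF J]]])
       (rule le)
  then have "c / 2 * I \<le> 2 * K / c * J" using ends by simp
  then have IJ: "I \<le> 4 * K / c\<^sup>2 * J" using c by (simp add: field_simps power2_eq_square)
  have "(\<integral>\<^sup>+ r\<in>{a..b}. ennreal ((u r)\<^sup>2 * p r) \<partial>lborel) = ennreal I"
    by (rule nn_integral_has_integral_lebesgue'[OF _ I]) (use p0 in auto)
  moreover have "(\<integral>\<^sup>+ r\<in>{a..b}. ennreal ((u' r)\<^sup>2 * q r) \<partial>lborel) = ennreal J"
    by (rule nn_integral_has_integral_lebesgue'[OF _ J]) (use q0 in auto)
  moreover have "0 \<le> J" by (rule has_integral_nonneg[OF J]) (use q0 in auto)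
  ultimately show ?thesis using IJ K by (simp flip: ennreal_mult' add: ennreal_leI)
qed

text \<open>The counterpart for \<open>u = 1\<close>, where no gradient term arises and
  \<open>M'\<close> is integrated directly. With the same two choices of \<open>M\<close> it shows
  that the radial weight has finite total mass, so that constants can be estimated against
  it.\<close>

lemma nn_integral_le_of_deriv_le:
  fixes M M' p :: "real \<Rightarrow> real"
  assumes ab: "a \<le> b" and c: "c > 0"
    and dM: "\<And>r. r \<in> {a..b} \<Longrightarrow> (M has_real_derivative M' r) (at r)"
    and cont: "continuous_on {a..b} p"
    and p0: "\<And>r. r \<in> {a..b} \<Longrightarrow> 0 \<le> p r"
    and M'_le: "\<And>r. r \<in> {a..b} \<Longrightarrow> M' r \<le> - c * p r"
  shows "(\<integral>\<^sup>+ r\<in>{a..b}. ennreal (p r) \<partial>lborel) \<le> ennreal ((M a - M b) / c)"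
proof -
  define I where "I = integral {a..b} p"
  have I: "(p has_integral I) {a..b}" unfolding I_def
    by (intro integrable_integral integrable_continuous_interval cont)
  have F: "(M' has_integral (M b - M a)) {a..b}"
    using dM by (intro fundamental_theorem_of_calculus[OF ab])
      (auto simp: has_real_derivative_iff_has_vector_derivative has_vector_derivative_at_within)
  have "M b - M a \<le> - c * I"
    by (rule has_integral_le[OF F has_integral_mult_right[OF I]]) (rule M'_le)
  then have "I \<le> (M a - M b) / c" using c by (simp add: field_simps)
  moreover have "(\<integral>\<^sup>+ r\<in>{a..b}. ennreal (p r) \<partial>lborel) = ennreal I"
    by (rule nn_integral_has_integral_lebesgue'[OF _ I]) (use p0 in auto)
  ultimately show ?thesis by (simp add: ennreal_leI)
qed

text \<open>The weights may be singular at 0, so the estimates are proved on compact intervals away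
  from 0. Exhausting the half-line by the increasing intervals \<open>S n\<close> around
  \<open>t\<close> carries uniform bounds over. The cut at \<open>t\<close> allows a different
  function \<open>M\<close> on either side.\<close>

lemma nn_integral_Ioi_le:
  fixes f :: "real \<Rightarrow> ennreal"
  assumes f[measurable]: "f \<in> borel_measurable borel" and t: "t > 0"
    and le: "\<And>a b. 0 < a \<Longrightarrow> a \<le> t \<Longrightarrow> t \<le> b \<Longrightarrow> (\<integral>\<^sup>+r\<in>{a..t}. f r \<partial>lborel) \<le> A \<and> (\<integral>\<^sup>+r\<in>{t..b}. f r \<partial>lborel) \<le> B"
  shows "(\<integral>\<^sup>+r\<in>{0<..}. f r \<partial>lborel) \<le> A + B"
proof -
  define S where "S = (\<lambda>n::nat. {t / (real n + 1)..t * (real n + 1)})"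
  have S_mono: "incseq S" unfolding S_def incseq_def
    using t by (auto simp: field_simps intro: order_trans)
  have S_Un: "(\<Union>n. S n) = {0<..}"
  proof (intro equalityI subsetI)
    fix r :: real assume "r \<in> {0<..}"
    then have r: "r > 0" by simp
    obtain n where n: "max (t / r) (r / t) \<le> real n" using real_arch_simple by blast
    then have "t \<le> r * real n" "r \<le> t * real n" using t r by (auto simp: field_simps)
    then have "r \<in> S n" using t r by (auto simp: S_def field_simps)
    then show "r \<in> (\<Union>n. S n)" by blast
  next
    fix r assume "r \<in> (\<Union>n. S n)"
    then obtain n where "t / (real n + 1) \<le> r" by (auto simp: S_def)
    moreover have "t / (real n + 1) > 0" using t by simp
    ultimately show "r \<in> {0<..}" by (metis greaterThan_iff less_le_trans)
  qed
  have "(\<integral>\<^sup>+r\<in>{0<..}. f r \<partial>lborel) = emeasure (density lborel f) (\<Union>n. S n)"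
    unfolding S_Un by (simp add: emeasure_density)
  also have "\<dots> = (SUP n. emeasure (density lborel f) (S n))"
    by (rule SUP_emeasure_incseq[symmetric]) (use S_mono in \<open>auto simp: S_def\<close>)
  also have "\<dots> \<le> A + B"
  proof (rule SUP_least)
    fix n
    have "t / (real n + 1) \<le> t" "t \<le> t * (real n + 1)" "0 < t / (real n + 1)"
      using t by (auto simp: field_simps)
    note le = le[OF this(3,1,2)]
    have "emeasure (density lborel f) (S n) \<le> emeasure (density lborel f) ({t / (real n + 1)..t} \<union> {t..t * (real n + 1)})"
      by (rule emeasure_mono) (auto simp: S_def)
    also have "\<dots> \<le> emeasure (density lborel f) {t / (real n + 1)..t} + emeasure (density lborel f) {t..t * (real n + 1)}"
      by (rule emeasure_subadditive) auto
    also have "\<dots> \<le> A + B"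
      using le by (intro add_mono) (auto simp: emeasure_density)
    finally show "emeasure (density lborel f) (S n) \<le> A + B" .
  qed
  finally show ?thesis .
qed

section \<open>Radial weights and the estimate along a single ray\<close>

text \<open>For \<open>k = n - 1 - b\<close> this is the restriction to a ray of the weight with
  singularity \<open>norm y powr (- b)\<close> in dimension \<open>n\<close>, with the Jacobian
  \<open>r ^ (n - 1)\<close> of polar coordinates absorbed into the power.\<close>

definition radial_wt :: "real \<Rightarrow> real \<Rightarrow> real \<Rightarrow> real \<Rightarrow> real"
  where "radial_wt \<alpha> \<delta> k r = r powr k * exp (- \<delta> * r powr \<alpha>)"

lemma radial_wt_nonneg: "0 \<le> radial_wt \<alpha> \<delta> k r"
  by (simp add: radial_wt_def)

lemma radial_wt_cont: "a > 0 \<Longrightarrow> continuous_on {a..b} (radial_wt \<alpha> \<delta> k)"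
  unfolding radial_wt_def by (intro continuous_intros) auto

lemma radial_wt_meas[measurable]: "radial_wt \<alpha> \<delta> k \<in> borel_measurable borel"
  unfolding radial_wt_def by measurable

lemma radial_wt_deriv:
  assumes "r > 0"
  shows "(radial_wt \<alpha> \<delta> k has_real_derivative (k * radial_wt \<alpha> \<delta> (k - 1) r - \<delta> * \<alpha> * radial_wt \<alpha> \<delta> (k + \<alpha> - 1) r)) (at r)"
  unfolding radial_wt_def using assms
  by (auto intro!: derivative_eq_intros simp: algebra_simps powr_add powr_diff)

context
  fixes m m' \<alpha> \<delta> :: real
  assumes m: "m > -1" and \<alpha>: "\<alpha> > 0" and \<delta>: "\<delta> > 0"
    and m'_le: "m' \<le> m + 2" and m'_ge: "m + 2 - 2 * \<alpha> \<le> m'"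
begin

text \<open>\<open>r\<^bsup>m + 1 - \<alpha>\<^esup> exp (- \<delta> r\<^bsup>\<alpha>\<^esup>)\<close> is, up to the factor \<open>\<delta> \<alpha>\<close>, the leading term at infinity of the
  tail integral of \<open>radial_wt \<alpha> \<delta> m\<close>.\<close>

lemma tail_deriv_le:
  obtains R where "R \<ge> 1" "\<And>r. r \<ge> R \<Longrightarrow>
     (m + 1 - \<alpha>) * radial_wt \<alpha> \<delta> (m - \<alpha>) r - \<delta> * \<alpha> * radial_wt \<alpha> \<delta> m r \<le> - (\<delta> * \<alpha> / 2) * radial_wt \<alpha> \<delta> m r"
proof -
  \<comment> \<open>Once \<open>r powr \<alpha> \<ge> b\<close>, the lower-order term with factor
    \<open>m + 1 - \<alpha>\<close> uses up at most half of the main term with factor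
    \<open>\<delta> * \<alpha>\<close>.\<close>
  define b where "b = 2 * \<bar>m + 1 - \<alpha>\<bar> / (\<delta> * \<alpha>)"
  have b0: "b \<ge> 0" using \<alpha> \<delta> by (simp add: b_def)
  show thesis
  proof (rule that[of "max 1 (b powr (1 / \<alpha>))"])
    fix r assume r: "max 1 (b powr (1 / \<alpha>)) \<le> r"
    then have "(b powr (1 / \<alpha>)) powr \<alpha> \<le> r powr \<alpha>" using \<alpha> by (intro powr_mono2) auto
    then have "b \<le> r powr \<alpha>" using b0 \<alpha> by (simp add: powr_powr)
    then have "\<bar>m + 1 - \<alpha>\<bar> \<le> \<delta> * \<alpha> / 2 * r powr \<alpha>" using \<alpha> \<delta> by (simp add: b_def field_simps)
    then have "m + 1 - \<alpha> \<le> \<delta> * \<alpha> / 2 * r powr \<alpha>" by linarith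
    then have "(m + 1 - \<alpha>) * radial_wt \<alpha> \<delta> (m - \<alpha>) r \<le> \<delta> * \<alpha> / 2 * r powr \<alpha> * radial_wt \<alpha> \<delta> (m - \<alpha>) r"
      by (intro mult_right_mono radial_wt_nonneg)
    also have "\<dots> = \<delta> * \<alpha> / 2 * radial_wt \<alpha> \<delta> m r" using r by (simp add: radial_wt_def powr_diff)
    finally show "(m + 1 - \<alpha>) * radial_wt \<alpha> \<delta> (m - \<alpha>) r - \<delta> * \<alpha> * radial_wt \<alpha> \<delta> m r \<le> - (\<delta> * \<alpha> / 2) * radial_wt \<alpha> \<delta> m r"
      by (simp add: field_simps)
  qed simp
qed

text \<open>This is the condition \<open>M' \<le> - c * p\<close> for
  \<open>M = - (r powr (m + 1))\<close> and \<open>c = m + 1 > 0\<close>. It holds because the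
  exponential factor in the weight is at most 1.\<close>

lemma head_deriv_le:
  assumes "r > 0"
  shows "- (m + 1) * r powr m \<le> - (m + 1) * radial_wt \<alpha> \<delta> m r"
  using m assms \<alpha> \<delta> by (simp add: radial_wt_def mult_left_le)

lemma head_deriv:
  assumes "r > 0"
  shows "((\<lambda>r. - (r powr (m + 1))) has_real_derivative - (m + 1) * r powr m) (at r)"
  using assms by (auto intro!: derivative_eq_intros simp: algebra_simps)

text \<open>The half-line is cut at \<open>t\<close>, where \<open>u = \<phi> - \<phi> t\<close>
  vanishes. The remaining end terms then have the right sign, because \<open>M\<close> is
  nonpositive on the inner piece and nonnegative on the outer one. The bound
  \<open>t \<ge> R\<close> puts the outer piece where the tail estimate holds, and
  \<open>t \<le> 2 * R\<close> makes the inner constant independent of \<open>t\<close>.\<close>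

lemma radial_sq_diff_le:
  obtains R K P where "R \<ge> 1" "K > 0" "P \<ge> 0"
    "(\<integral>\<^sup>+r\<in>{0<..}. ennreal (radial_wt \<alpha> \<delta> m r) \<partial>lborel) \<le> ennreal P"
    "\<And>\<phi> \<phi>' t. t \<in> {R..2 * R} \<Longrightarrow> (\<And>r. r > 0 \<Longrightarrow> (\<phi> has_real_derivative \<phi>' r) (at r)) \<Longrightarrow>
       continuous_on UNIV \<phi> \<Longrightarrow> continuous_on UNIV \<phi>' \<Longrightarrow>
       (\<integral>\<^sup>+r\<in>{0<..}. ennreal ((\<phi> r - \<phi> t)\<^sup>2 * radial_wt \<alpha> \<delta> m r) \<partial>lborel)
        \<le> ennreal K * (\<integral>\<^sup>+r\<in>{0<..}. ennreal ((\<phi>' r)\<^sup>2 * radial_wt \<alpha> \<delta> m' r) \<partial>lborel)"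
proof -
  obtain R where R: "R \<ge> 1" and tail: "\<And>r. r \<ge> R \<Longrightarrow>
     (m + 1 - \<alpha>) * radial_wt \<alpha> \<delta> (m - \<alpha>) r - \<delta> * \<alpha> * radial_wt \<alpha> \<delta> m r \<le> - (\<delta> * \<alpha> / 2) * radial_wt \<alpha> \<delta> m r"
    by (rule tail_deriv_le) (rule that)
  have tail_deriv: "(radial_wt \<alpha> \<delta> (m + 1 - \<alpha>) has_real_derivative ((m + 1 - \<alpha>) * radial_wt \<alpha> \<delta> (m - \<alpha>) r - \<delta> * \<alpha> * radial_wt \<alpha> \<delta> m r)) (at r)"
    if "r > 0" for r using radial_wt_deriv[OF that, of \<alpha> \<delta> "m + 1 - \<alpha>"] by simp
  \<comment> \<open>For \<open>M = - (r powr (m + 1))\<close> the quotient of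
    \<open>M\<^sup>2\<close> by the product of the two weights is
    \<open>r powr (m + 2 - m') * exp (2 * \<delta> * r powr \<alpha>)\<close>. It is nondecreasing
    because \<open>m' \<le> m + 2\<close>, and \<open>K0\<close> is its value at
    \<open>2 * R\<close>.\<close>
  define K0 where "K0 = (2 * R) powr (m + 2 - m') * exp (2 * \<delta> * (2 * R) powr \<alpha>)"
  have K0: "K0 \<ge> 0" by (simp add: K0_def)
  have c: "\<delta> * \<alpha> / 2 > 0" using \<delta> \<alpha> by simp
  have head_sq: "(- (r powr (m + 1)))\<^sup>2 \<le> K0 * (radial_wt \<alpha> \<delta> m r * radial_wt \<alpha> \<delta> m' r)" if r: "0 < r" "r \<le> 2 * R" for r
  proof -
    have "(- (r powr (m + 1)))\<^sup>2 = r powr m * r powr m' * (r powr (m + 2 - m') * 1)"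
      using r by (simp add: power2_eq_square flip: powr_add)
    also have "\<dots> \<le> r powr m * r powr m' * ((2 * R) powr (m + 2 - m') * exp (2 * \<delta> * (2 * R) powr \<alpha> - 2 * \<delta> * r powr \<alpha>))"
    proof (intro mult_left_mono mult_mono)
      show "r powr (m + 2 - m') \<le> (2 * R) powr (m + 2 - m')"
        using r m'_le by (intro powr_mono2) auto
      have "r powr \<alpha> \<le> (2 * R) powr \<alpha>" using r \<alpha> by (intro powr_mono2) auto
      then show "1 \<le> exp (2 * \<delta> * (2 * R) powr \<alpha> - 2 * \<delta> * r powr \<alpha>)" using \<delta> by simp
    qed auto
    also have "\<dots> = K0 * (radial_wt \<alpha> \<delta> m r * radial_wt \<alpha> \<delta> m' r)"
      by (simp add: K0_def radial_wt_def exp_diff exp_minus field_simps flip: exp_add)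
    finally show ?thesis .
  qed
  \<comment> \<open>Both sides carry the same exponential factors, so only powers are compared. As
    \<open>r \<ge> 1\<close>, this is the comparison of exponents
    \<open>m + 2 - 2 * \<alpha> \<le> m'\<close>, with constant 1.\<close>
  have tail_sq: "(radial_wt \<alpha> \<delta> (m + 1 - \<alpha>) r)\<^sup>2 \<le> 1 * (radial_wt \<alpha> \<delta> m r * radial_wt \<alpha> \<delta> m' r)" if r: "r \<ge> R" for r
  proof -
    have "r powr (m + 1 - \<alpha>) * r powr (m + 1 - \<alpha>) = r powr (m + (m + 2 - 2 * \<alpha>))"
      by (simp flip: powr_add)
    also have "\<dots> \<le> r powr (m + m')" using r R m'_ge by (intro powr_mono) auto
    also have "\<dots> = r powr m * r powr m'" by (rule powr_add)
    finally have "r powr (m + 1 - \<alpha>) * r powr (m + 1 - \<alpha>) * (exp (- \<delta> * r powr \<alpha>) * exp (- \<delta> * r powr \<alpha>))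
       \<le> r powr m * r powr m' * (exp (- \<delta> * r powr \<alpha>) * exp (- \<delta> * r powr \<alpha>))"
      by (rule mult_right_mono) simp
    then show ?thesis by (simp add: radial_wt_def power2_eq_square mult_ac)
  qed
  define P1 where "P1 = R powr (m + 1) / (m + 1)"
  define P2 where "P2 = radial_wt \<alpha> \<delta> (m + 1 - \<alpha>) R / (\<delta> * \<alpha> / 2)"
  have P: "P1 \<ge> 0" "P2 \<ge> 0" using m c radial_wt_nonneg by (auto simp: P1_def P2_def)
  have int: "(\<integral>\<^sup>+r\<in>{0<..}. ennreal (radial_wt \<alpha> \<delta> m r) \<partial>lborel) \<le> ennreal P1 + ennreal P2"
  proof (rule nn_integral_Ioi_le[where t=R])
    fix a b assume ab: "0 < a" "a \<le> R" "R \<le> b"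
    have "(\<integral>\<^sup>+r\<in>{a..R}. ennreal (radial_wt \<alpha> \<delta> m r) \<partial>lborel) \<le> ennreal ((- (a powr (m + 1)) - - (R powr (m + 1))) / (m + 1))"
      using ab m head_deriv_le
      by (intro nn_integral_le_of_deriv_le[OF _ _ head_deriv] radial_wt_cont radial_wt_nonneg) auto
    also have "\<dots> \<le> ennreal P1" using m unfolding P1_def by (intro ennreal_leI divide_right_mono) auto
    finally have 1: "(\<integral>\<^sup>+r\<in>{a..R}. ennreal (radial_wt \<alpha> \<delta> m r) \<partial>lborel) \<le> ennreal P1" .
    have "(\<integral>\<^sup>+r\<in>{R..b}. ennreal (radial_wt \<alpha> \<delta> m r) \<partial>lborel) \<le> ennreal ((radial_wt \<alpha> \<delta> (m + 1 - \<alpha>) R - radial_wt \<alpha> \<delta> (m + 1 - \<alpha>) b) / (\<delta> * \<alpha> / 2))"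
      using ab R by (intro nn_integral_le_of_deriv_le[OF _ c tail_deriv] radial_wt_cont radial_wt_nonneg tail) auto
    also have "\<dots> \<le> ennreal P2" using c radial_wt_nonneg unfolding P2_def by (intro ennreal_leI divide_right_mono) auto
    finally show "(\<integral>\<^sup>+r\<in>{a..R}. ennreal (radial_wt \<alpha> \<delta> m r) \<partial>lborel) \<le> ennreal P1 \<and> (\<integral>\<^sup>+r\<in>{R..b}. ennreal (radial_wt \<alpha> \<delta> m r) \<partial>lborel) \<le> ennreal P2"
      using 1 by simp
  qed (use R in auto)
  define K1 where "K1 = 4 * K0 / (m + 1)\<^sup>2"
  define K2 where "K2 = 4 * 1 / (\<delta> * \<alpha> / 2)\<^sup>2"
  have K12: "K1 \<ge> 0" "K2 > 0" using K0 \<alpha> \<delta> by (auto simp: K1_def K2_def)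
  show thesis
  proof (rule that[of R "K1 + K2" "P1 + P2"])
    show "(\<integral>\<^sup>+r\<in>{0<..}. ennreal (radial_wt \<alpha> \<delta> m r) \<partial>lborel) \<le> ennreal (P1 + P2)"
      using int P by simp
  next
    fix \<phi> \<phi>' :: "real \<Rightarrow> real" and t
    assume t: "t \<in> {R..2 * R}" and d: "\<And>r. r > 0 \<Longrightarrow> (\<phi> has_real_derivative \<phi>' r) (at r)"
      and c\<phi>: "continuous_on UNIV \<phi>" and c\<phi>': "continuous_on UNIV \<phi>'"
    let ?Q = "(\<integral>\<^sup>+r\<in>{0<..}. ennreal ((\<phi>' r)\<^sup>2 * radial_wt \<alpha> \<delta> m' r) \<partial>lborel)"
    have [measurable]: "\<phi> \<in> borel_measurable borel" using c\<phi> by (rule borel_measurable_continuous_onI)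
    have d': "((\<lambda>r. \<phi> r - \<phi> t) has_real_derivative \<phi>' r) (at r)" if "r > 0" for r
      using d[OF that] by (auto intro!: derivative_eq_intros)
    have Q: "(\<integral>\<^sup>+r\<in>{a..b}. ennreal ((\<phi>' r)\<^sup>2 * radial_wt \<alpha> \<delta> m' r) \<partial>lborel) \<le> ?Q" if "a > 0" for a b
      using that by (intro nn_set_integral_set_mono) auto
    have "(\<integral>\<^sup>+r\<in>{0<..}. ennreal ((\<phi> r - \<phi> t)\<^sup>2 * radial_wt \<alpha> \<delta> m r) \<partial>lborel) \<le> ennreal K1 * ?Q + ennreal K2 * ?Q"
    proof (rule nn_integral_Ioi_le[where t=t])
      fix a b assume ab: "0 < a" "a \<le> t" "t \<le> b"
      have "(\<integral>\<^sup>+r\<in>{a..t}. ennreal ((\<phi> r - \<phi> t)\<^sup>2 * radial_wt \<alpha> \<delta> m r) \<partial>lborel)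
        \<le> ennreal K1 * (\<integral>\<^sup>+r\<in>{a..t}. ennreal ((\<phi>' r)\<^sup>2 * radial_wt \<alpha> \<delta> m' r) \<partial>lborel)"
        unfolding K1_def using ab t m head_deriv_le
        by (intro integral_weighted_sq_le[OF _ _ d' head_deriv _ _ _ _ _ _ head_sq K0]
              radial_wt_cont radial_wt_nonneg continuous_on_subset[OF c\<phi>'])
           (auto simp: mult_nonneg_nonneg)
      also have "\<dots> \<le> ennreal K1 * ?Q" by (intro mult_left_mono Q ab) simp
      finally have 1: "(\<integral>\<^sup>+r\<in>{a..t}. ennreal ((\<phi> r - \<phi> t)\<^sup>2 * radial_wt \<alpha> \<delta> m r) \<partial>lborel) \<le> ennreal K1 * ?Q" .
      have "(\<integral>\<^sup>+r\<in>{t..b}. ennreal ((\<phi> r - \<phi> t)\<^sup>2 * radial_wt \<alpha> \<delta> m r) \<partial>lborel)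
        \<le> ennreal K2 * (\<integral>\<^sup>+r\<in>{t..b}. ennreal ((\<phi>' r)\<^sup>2 * radial_wt \<alpha> \<delta> m' r) \<partial>lborel)"
        unfolding K2_def using ab t R
        by (intro integral_weighted_sq_le[OF _ c d' tail_deriv _ _ _ _ _ _ tail_sq]
              radial_wt_cont radial_wt_nonneg tail continuous_on_subset[OF c\<phi>'])
           (auto simp: radial_wt_nonneg mult_nonneg_nonneg)
      also have "\<dots> \<le> ennreal K2 * ?Q" by (intro mult_left_mono Q) (use ab in auto)
      finally show "(\<integral>\<^sup>+r\<in>{a..t}. ennreal ((\<phi> r - \<phi> t)\<^sup>2 * radial_wt \<alpha> \<delta> m r) \<partial>lborel) \<le> ennreal K1 * ?Q
         \<and> (\<integral>\<^sup>+r\<in>{t..b}. ennreal ((\<phi> r - \<phi> t)\<^sup>2 * radial_wt \<alpha> \<delta> m r) \<partial>lborel) \<le> ennreal K2 * ?Q"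
        using 1 by simp
    qed (use t R in auto)
    then show "(\<integral>\<^sup>+r\<in>{0<..}. ennreal ((\<phi> r - \<phi> t)\<^sup>2 * radial_wt \<alpha> \<delta> m r) \<partial>lborel) \<le> ennreal (K1 + K2) * ?Q"
      using K12 by (simp add: distrib_right)
  qed (use R K12 P in auto)
qed

text \<open>Replaces the anchor value \<open>\<phi> t\<close> by an arbitrary constant
  \<open>c\<close>, which can be the same on all rays. The price
  \<open>(\<phi> t - c)\<^sup>2\<close> times the finite mass of the weight is averaged over
  \<open>t\<close>. The factor \<open>r ^ k\<close> is at least 1 on \<open>{R..2 * R}\<close>; it
  later serves as the polar Jacobian of an unweighted integral.\<close>

lemma radial_sq_le:
  obtains R K where "R \<ge> 1" "K > 0"
    "\<And>\<phi> \<phi>' c k. (\<And>r. r > 0 \<Longrightarrow> (\<phi> has_real_derivative \<phi>' r) (at r)) \<Longrightarrow>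
       continuous_on UNIV \<phi> \<Longrightarrow> continuous_on UNIV \<phi>' \<Longrightarrow>
       (\<integral>\<^sup>+r\<in>{0<..}. ennreal ((\<phi> r - c)\<^sup>2 * radial_wt \<alpha> \<delta> m r) \<partial>lborel)
        \<le> ennreal K * ((\<integral>\<^sup>+r\<in>{0<..}. ennreal ((\<phi>' r)\<^sup>2 * radial_wt \<alpha> \<delta> m' r) \<partial>lborel)
          + (\<integral>\<^sup>+r\<in>{R..2 * R}. ennreal ((\<phi> r - c)\<^sup>2 * r ^ k) \<partial>lborel))"
proof (rule radial_sq_diff_le)
  fix R K P
  assume R: "R \<ge> 1" and K: "K > 0" and P: "P \<ge> 0"
    and int: "(\<integral>\<^sup>+r\<in>{0<..}. ennreal (radial_wt \<alpha> \<delta> m r) \<partial>lborel) \<le> ennreal P"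
    and le: "\<And>\<phi> \<phi>' t. t \<in> {R..2 * R} \<Longrightarrow> (\<And>r. r > 0 \<Longrightarrow> (\<phi> has_real_derivative \<phi>' r) (at r)) \<Longrightarrow>
       continuous_on UNIV \<phi> \<Longrightarrow> continuous_on UNIV \<phi>' \<Longrightarrow>
       (\<integral>\<^sup>+r\<in>{0<..}. ennreal ((\<phi> r - \<phi> t)\<^sup>2 * radial_wt \<alpha> \<delta> m r) \<partial>lborel)
        \<le> ennreal K * (\<integral>\<^sup>+r\<in>{0<..}. ennreal ((\<phi>' r)\<^sup>2 * radial_wt \<alpha> \<delta> m' r) \<partial>lborel)"
  \<comment> \<open>The terms \<open>2 * K\<close> and \<open>2 * P\<close> come from
    \<open>(x + y)\<^sup>2 \<le> 2 * x\<^sup>2 + 2 * y\<^sup>2\<close>, applied to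
    \<open>\<phi> r - c = (\<phi> r - \<phi> t) + (\<phi> t - c)\<close>.\<close>
  define K' where "K' = 2 * K + 2 * P + 1"
  show thesis
  proof (rule that[of R K'])
    fix \<phi> \<phi>' :: "real \<Rightarrow> real" and c and k :: nat
    assume d: "\<And>r. r > 0 \<Longrightarrow> (\<phi> has_real_derivative \<phi>' r) (at r)"
      and c\<phi>: "continuous_on UNIV \<phi>" and c\<phi>': "continuous_on UNIV \<phi>'"
    have [measurable]: "\<phi> \<in> borel_measurable borel" using c\<phi> by (rule borel_measurable_continuous_onI)
    define J where "J = (\<integral>\<^sup>+r\<in>{0<..}. ennreal ((\<phi> r - c)\<^sup>2 * radial_wt \<alpha> \<delta> m r) \<partial>lborel)"
    define Q where "Q = (\<integral>\<^sup>+r\<in>{0<..}. ennreal ((\<phi>' r)\<^sup>2 * radial_wt \<alpha> \<delta> m' r) \<partial>lborel)"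
    have J: "J \<le> ennreal K' * (Q + ennreal ((\<phi> t - c)\<^sup>2 * t ^ k))" if t: "t \<in> {R..2 * R}" for t
    proof -
      have "J \<le> (\<integral>\<^sup>+r. 2 * (ennreal ((\<phi> r - \<phi> t)\<^sup>2 * radial_wt \<alpha> \<delta> m r) * indicator {0<..} r)
           + ennreal (2 * (\<phi> t - c)\<^sup>2) * (ennreal (radial_wt \<alpha> \<delta> m r) * indicator {0<..} r) \<partial>lborel)"
        unfolding J_def
      proof (rule nn_integral_mono)
        fix r
        have "0 \<le> ((\<phi> r - \<phi> t) - (\<phi> t - c))\<^sup>2" by simp
        then have "(\<phi> r - c)\<^sup>2 \<le> 2 * (\<phi> r - \<phi> t)\<^sup>2 + 2 * (\<phi> t - c)\<^sup>2"
          by (simp add: power2_eq_square algebra_simps)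
        then have "(\<phi> r - c)\<^sup>2 * radial_wt \<alpha> \<delta> m r \<le> (2 * (\<phi> r - \<phi> t)\<^sup>2 + 2 * (\<phi> t - c)\<^sup>2) * radial_wt \<alpha> \<delta> m r"
          by (intro mult_right_mono radial_wt_nonneg)
        also have "\<dots> = 2 * ((\<phi> r - \<phi> t)\<^sup>2 * radial_wt \<alpha> \<delta> m r) + 2 * (\<phi> t - c)\<^sup>2 * radial_wt \<alpha> \<delta> m r"
          by (simp add: algebra_simps)
        finally have "ennreal ((\<phi> r - c)\<^sup>2 * radial_wt \<alpha> \<delta> m r) \<le> ennreal (2 * ((\<phi> r - \<phi> t)\<^sup>2 * radial_wt \<alpha> \<delta> m r) + 2 * (\<phi> t - c)\<^sup>2 * radial_wt \<alpha> \<delta> m r)"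
          by (rule ennreal_leI)
        also have "\<dots> = 2 * ennreal ((\<phi> r - \<phi> t)\<^sup>2 * radial_wt \<alpha> \<delta> m r) + ennreal (2 * (\<phi> t - c)\<^sup>2) * ennreal (radial_wt \<alpha> \<delta> m r)"
          by (simp add: radial_wt_nonneg ennreal_mult' ennreal_plus)
        finally show "ennreal ((\<phi> r - c)\<^sup>2 * radial_wt \<alpha> \<delta> m r) * indicator {0<..} r \<le>
           2 * (ennreal ((\<phi> r - \<phi> t)\<^sup>2 * radial_wt \<alpha> \<delta> m r) * indicator {0<..} r)
           + ennreal (2 * (\<phi> t - c)\<^sup>2) * (ennreal (radial_wt \<alpha> \<delta> m r) * indicator {0<..} r)"
          by (simp add: indicator_def)
      qed
      also have "\<dots> = 2 * (\<integral>\<^sup>+r\<in>{0<..}. ennreal ((\<phi> r - \<phi> t)\<^sup>2 * radial_wt \<alpha> \<delta> m r) \<partial>lborel)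
           + ennreal (2 * (\<phi> t - c)\<^sup>2) * (\<integral>\<^sup>+r\<in>{0<..}. ennreal (radial_wt \<alpha> \<delta> m r) \<partial>lborel)"
        by (simp add: nn_integral_add nn_integral_cmult)
      also have "\<dots> \<le> 2 * (ennreal K * Q) + ennreal (2 * (\<phi> t - c)\<^sup>2) * ennreal P"
        unfolding Q_def by (intro add_mono mult_left_mono le[OF t d c\<phi> c\<phi>'] int) auto
      also have "\<dots> = ennreal (2 * K) * Q + ennreal (2 * P * (\<phi> t - c)\<^sup>2)"
        using K P by (simp add: ennreal_mult' ennreal_mult'' mult_ac)
      also have "\<dots> \<le> ennreal K' * Q + ennreal (K' * ((\<phi> t - c)\<^sup>2 * t ^ k))"
      proof (intro add_mono mult_right_mono ennreal_leI)
        have "2 * P * (\<phi> t - c)\<^sup>2 \<le> K' * (\<phi> t - c)\<^sup>2"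
          using K P by (intro mult_right_mono) (auto simp: K'_def)
        also have "\<dots> * 1 \<le> K' * (\<phi> t - c)\<^sup>2 * t ^ k"
          using t R K P by (intro mult_left_mono one_le_power) (auto simp: K'_def)
        finally show "2 * P * (\<phi> t - c)\<^sup>2 \<le> K' * ((\<phi> t - c)\<^sup>2 * t ^ k)" by (simp add: mult_ac)
      qed (use K P in \<open>auto simp: K'_def\<close>)
      also have "\<dots> = ennreal K' * (Q + ennreal ((\<phi> t - c)\<^sup>2 * t ^ k))"
        using K P by (simp add: K'_def ennreal_mult' distrib_left)
      finally show ?thesis .
    qed
    \<comment> \<open>Average over \<open>t\<close> in an interval of length \<open>R\<close>. Since
      \<open>R \<ge> 1\<close>, the remainder may also be multiplied by \<open>R\<close>, after
      which \<open>R\<close> cancels.\<close>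
    have "J * ennreal R = (\<integral>\<^sup>+t\<in>{R..2 * R}. J \<partial>lborel)"
      using R by (simp add: nn_integral_cmult_indicator)
    also have "\<dots> \<le> (\<integral>\<^sup>+t. ennreal K' * (Q * indicator {R..2*R} t + ennreal ((\<phi> t - c)\<^sup>2 * t ^ k) * indicator {R..2*R} t) \<partial>lborel)"
      by (intro nn_integral_mono) (use J in \<open>auto simp: indicator_def\<close>)
    also have "\<dots> = ennreal K' * (Q * ennreal R + (\<integral>\<^sup>+t\<in>{R..2*R}. ennreal ((\<phi> t - c)\<^sup>2 * t ^ k) \<partial>lborel))"
      using R by (simp add: nn_integral_cmult nn_integral_add nn_integral_cmult_indicator)
    also have "\<dots> \<le> ennreal K' * ((Q + (\<integral>\<^sup>+t\<in>{R..2*R}. ennreal ((\<phi> t - c)\<^sup>2 * t ^ k) \<partial>lborel)) * ennreal R)"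
    proof -
      have "X \<le> X * ennreal R" for X
        using mult_left_mono[of 1 "ennreal R" X] R by simp
      then show ?thesis by (intro mult_left_mono) (auto simp: distrib_right intro!: add_mono)
    qed
    finally have "J * ennreal R \<le> ennreal K' * (Q + (\<integral>\<^sup>+t\<in>{R..2*R}. ennreal ((\<phi> t - c)\<^sup>2 * t ^ k) \<partial>lborel)) * ennreal R"
      by (simp add: mult.assoc)
    then have "J \<le> ennreal K' * (Q + (\<integral>\<^sup>+t\<in>{R..2*R}. ennreal ((\<phi> t - c)\<^sup>2 * t ^ k) \<partial>lborel))"
      using R by (subst (asm) (1 2) mult.commute) (auto simp: ennreal_mult_le_mult_iff)
    then show "(\<integral>\<^sup>+r\<in>{0<..}. ennreal ((\<phi> r - c)\<^sup>2 * radial_wt \<alpha> \<delta> m r) \<partial>lborel)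
        \<le> ennreal K' * ((\<integral>\<^sup>+r\<in>{0<..}. ennreal ((\<phi>' r)\<^sup>2 * radial_wt \<alpha> \<delta> m' r) \<partial>lborel)
          + (\<integral>\<^sup>+r\<in>{R..2 * R}. ennreal ((\<phi> r - c)\<^sup>2 * r ^ k) \<partial>lborel))"
      unfolding J_def Q_def .
  qed (use R K P in \<open>auto simp: K'_def\<close>)
qed

end

section \<open>Scaling of Lebesgue measure and polar coordinates\<close>

lemma nn_integral_lborel_scaleR:
  fixes f :: "'a::euclidean_space \<Rightarrow> ennreal"
  assumes [measurable]: "f \<in> borel_measurable borel" and c: "c \<noteq> 0"
  shows "(\<integral>\<^sup>+x. f x \<partial>lborel) = ennreal (\<bar>c\<bar> ^ DIM('a)) * (\<integral>\<^sup>+x. f (t + c *\<^sub>R x) \<partial>lborel)"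
  by (subst lborel_affine[OF c, of t])
     (simp add: nn_integral_density nn_integral_distr nn_integral_cmult)

lemma nn_integral_inverse_Icc:
  assumes "0 < a" "a \<le> b"
  shows "(\<integral>\<^sup>+ s\<in>{a..b}. ennreal (1 / s) \<partial>lborel) = ennreal (ln (b / a))"
proof -
  have "((\<lambda>s. 1 / s) has_integral (ln b - ln a)) {a..b}"
    using assms by (intro fundamental_theorem_of_calculus)
      (auto intro!: derivative_eq_intros simp flip: has_real_derivative_iff_has_vector_derivative)
  then show ?thesis
    using assms by (subst nn_integral_has_integral_lebesgue') (auto simp: ln_div)
qed

text \<open>Polar coordinates without a surface measure: the directions \<open>sgn x\<close> are averaged over the
  shell \<open>1 \<le> norm x \<le> 2\<close>. After the substitution \<open>r = s * norm x\<close>, Tonelli and the scaling of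
  Lebesgue measure reduce the identity to \<open>\<integral> 1 / s ds = ln 2\<close>.\<close>

lemma nn_integral_polar:
  fixes f :: "'a::euclidean_space \<Rightarrow> ennreal"
  assumes f[measurable]: "f \<in> borel_measurable borel"
  shows "ennreal (ln 2) * (\<integral>\<^sup>+x. f x \<partial>lborel) =
    (\<integral>\<^sup>+x\<in>{x. 1 \<le> norm x \<and> norm x \<le> 2}. ennreal (1 / norm x ^ DIM('a)) *
       (\<integral>\<^sup>+r\<in>{0<..}. f (r *\<^sub>R sgn x) * ennreal (r ^ (DIM('a) - 1)) \<partial>lborel) \<partial>lborel)"
    (is "_ = (\<integral>\<^sup>+x\<in>?A. _ x \<partial>lborel)")
proof -
  let ?n = "DIM('a)"
  have [measurable]: "?A \<in> sets borel" by measurable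
  have [measurable]: "(sgn :: 'a \<Rightarrow> 'a) \<in> borel_measurable borel"
    unfolding sgn_div_norm by measurable
  have inner: "ennreal (1 / norm x ^ ?n) *
       (\<integral>\<^sup>+r\<in>{0<..}. f (r *\<^sub>R sgn x) * ennreal (r ^ (?n - 1)) \<partial>lborel) 
      = (\<integral>\<^sup>+s\<in>{0<..}. f (s *\<^sub>R x) * ennreal (s ^ (?n - 1)) \<partial>lborel)" if "x \<in> ?A" for x
  proof -
    have x: "norm x > 0" using that by auto
    have eq: "f ((0 + norm x * s) *\<^sub>R sgn x) * ennreal ((0 + norm x * s) ^ (?n - 1)) * indicator {0<..} (0 + norm x * s)
        = ennreal (norm x ^ (?n - 1)) * (f (s *\<^sub>R x) * ennreal (s ^ (?n - 1)) * indicator {0<..} s)" for s :: real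
    proof -
      have "(0 + norm x * s) *\<^sub>R sgn x = s *\<^sub>R x" using x by (simp add: sgn_div_norm)
      moreover have "ennreal ((0 + norm x * s) ^ (?n - 1)) = ennreal (norm x ^ (?n - 1)) * ennreal (s ^ (?n - 1))"
        by (simp add: power_mult_distrib ennreal_mult')
      moreover have "indicator {0<..} (0 + norm x * s) = (indicator {0<..} s :: ennreal)"
        using x by (simp add: indicator_def zero_less_mult_iff)
      ultimately show ?thesis
        by (simp only: mult_ac)
    qed
    have "(\<integral>\<^sup>+r\<in>{0<..}. f (r *\<^sub>R sgn x) * ennreal (r ^ (?n - 1)) \<partial>lborel) =
      ennreal (norm x) * (\<integral>\<^sup>+s. f ((0 + norm x * s) *\<^sub>R sgn x) * ennreal ((0 + norm x * s) ^ (?n - 1)) * indicator {0<..} (0 + norm x * s) \<partial>lborel)"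
      by (subst nn_integral_real_affine[where c="norm x" and t=0]) (use x in auto)
    also have "\<dots> = ennreal (norm x) * (\<integral>\<^sup>+s. ennreal (norm x ^ (?n - 1)) * (f (s *\<^sub>R x) * ennreal (s ^ (?n - 1)) * indicator {0<..} s) \<partial>lborel)"
      by (simp only: eq)
    also have "\<dots> = ennreal (norm x ^ ?n) * (\<integral>\<^sup>+s\<in>{0<..}. f (s *\<^sub>R x) * ennreal (s ^ (?n - 1)) \<partial>lborel)"
      by (subst nn_integral_cmult) (auto simp: ennreal_mult' power_eq_if mult.assoc)
    finally show ?thesis
      using x by (simp add: mult.assoc[symmetric] flip: ennreal_mult'')
  qed
  have "(\<integral>\<^sup>+x\<in>?A. (ennreal (1 / norm x ^ ?n) *
       (\<integral>\<^sup>+r\<in>{0<..}. f (r *\<^sub>R sgn x) * ennreal (r ^ (?n - 1)) \<partial>lborel)) \<partial>lborel)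
     = (\<integral>\<^sup>+x. (\<integral>\<^sup>+s. indicator ?A x * (f (s *\<^sub>R x) * ennreal (s ^ (?n - 1)) * indicator {0<..} s) \<partial>lborel) \<partial>lborel)"
    proof (rule nn_integral_cong)
    fix x :: 'a
    show "ennreal (1 / norm x ^ ?n) * (\<integral>\<^sup>+r\<in>{0<..}. f (r *\<^sub>R sgn x) * ennreal (r ^ (?n - 1)) \<partial>lborel) * indicator ?A x
      = (\<integral>\<^sup>+s. indicator ?A x * (f (s *\<^sub>R x) * ennreal (s ^ (?n - 1)) * indicator {0<..} s) \<partial>lborel)"
      using inner[of x] by (cases "x \<in> ?A") auto
  qed
  also have "\<dots> = (\<integral>\<^sup>+s. (\<integral>\<^sup>+x. indicator ?A x * (f (s *\<^sub>R x) * ennreal (s ^ (?n - 1)) * indicator {0<..} s) \<partial>lborel) \<partial>lborel)"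
    by (rule lborel_pair.Fubini') measurable
  \<comment> \<open>For fixed \<open>s > 0\<close> put \<open>y = s *\<^sub>R x\<close>. The shell
    condition on \<open>x\<close> becomes \<open>norm y / 2 \<le> s \<le> norm y\<close>, and the
    Jacobian combines with \<open>s ^ (?n - 1)\<close> to \<open>1 / s\<close>.\<close>
  also have "\<dots> = (\<integral>\<^sup>+s. (\<integral>\<^sup>+y. indicator {norm y / 2..norm y} s * (ennreal (1 / s) * f y * indicator {0<..} s) \<partial>lborel) \<partial>lborel)"
  proof (rule nn_integral_cong)
    fix s :: real
    show "(\<integral>\<^sup>+x. indicator ?A x * (f (s *\<^sub>R x) * ennreal (s ^ (?n - 1)) * indicator {0<..} s) \<partial>lborel)
      = (\<integral>\<^sup>+y. indicator {norm y / 2..norm y} s * (ennreal (1 / s) * f y * indicator {0<..} s) \<partial>lborel)"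
    proof (cases "s > 0")
      case True
      have "(\<integral>\<^sup>+y. indicator {norm y / 2..norm y} s * (ennreal (1 / s) * f y * indicator {0<..} s) \<partial>lborel)
        = ennreal (s ^ ?n) * (\<integral>\<^sup>+x. indicator {norm (0 + s *\<^sub>R x) / 2..norm (0 + s *\<^sub>R x)} s * (ennreal (1 / s) * f (0 + s *\<^sub>R x) * indicator {0<..} s) \<partial>lborel)"
        by (subst nn_integral_lborel_scaleR[where c=s and t=0]) (use True in \<open>auto simp: indicator_def\<close>)
      also have "\<dots> = (\<integral>\<^sup>+x. ennreal (s ^ ?n) * (indicator {norm (0 + s *\<^sub>R x) / 2..norm (0 + s *\<^sub>R x)} s * (ennreal (1 / s) * f (0 + s *\<^sub>R x) * indicator {0<..} s)) \<partial>lborel)"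
        by (subst nn_integral_cmult) (auto simp: indicator_def)
      also have "\<dots> = (\<integral>\<^sup>+x. indicator ?A x * (f (s *\<^sub>R x) * ennreal (s ^ (?n - 1)) * indicator {0<..} s) \<partial>lborel)"
      proof (rule nn_integral_cong)
        fix x :: 'a
        have "s ^ ?n * (1 / s) = s ^ (?n - 1)"
          using True by (simp add: power_eq_if)
        then have *: "ennreal (s ^ ?n) * ennreal (1 / s) = ennreal (s ^ (?n - 1))"
          using True by (simp flip: ennreal_mult')
        have "norm (s *\<^sub>R x) / 2 \<le> s \<and> s \<le> norm (s *\<^sub>R x) \<longleftrightarrow> x \<in> ?A"
          using True by auto
        then show "ennreal (s ^ ?n) * (indicator {norm (0 + s *\<^sub>R x) / 2..norm (0 + s *\<^sub>R x)} s * (ennreal (1 / s) * f (0 + s *\<^sub>R x) * indicator {0<..} s)) = indicator ?A x * (f (s *\<^sub>R x) * ennreal (s ^ (?n - 1)) * indicator {0<..} s)"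
          using True by (auto simp: indicator_def mult.assoc[symmetric] *) (simp add: mult.commute)
      qed
      finally show ?thesis by simp
    qed auto
  qed
  also have "\<dots> = (\<integral>\<^sup>+y. (\<integral>\<^sup>+s. indicator {norm y / 2..norm y} s * (ennreal (1 / s) * f y * indicator {0<..} s) \<partial>lborel) \<partial>lborel)"
    by (rule lborel_pair.Fubini') (auto simp: indicator_def)
  \<comment> \<open>The interval for \<open>s\<close> has endpoint ratio 2 whatever
    \<open>y \<noteq> 0\<close> is, so the inner integral is always \<open>ln 2\<close>. It
    degenerates only at the origin, a null set.\<close>
  also have "\<dots> = (\<integral>\<^sup>+y. ennreal (ln 2) * f y \<partial>lborel)"
  proof (rule nn_integral_cong_AE)
    show "AE y in lborel. (\<integral>\<^sup>+s. indicator {norm y / 2..norm y} s * (ennreal (1 / s) * f y * indicator {0<..} s) \<partial>lborel) = ennreal (ln 2) * f y"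
      using AE_lborel_singleton[of "0::'a"]
    proof eventually_elim
      case (elim y)
      have "(\<integral>\<^sup>+s. indicator {norm y / 2..norm y} s * (ennreal (1 / s) * f y * indicator {0<..} s) \<partial>lborel)
         = (\<integral>\<^sup>+s. f y * (ennreal (1 / s) * indicator {norm y / 2..norm y} s) \<partial>lborel)"
        using elim by (intro nn_integral_cong) (auto simp: indicator_def mult.commute)
      also have "\<dots> = f y * ennreal (ln 2)"
        using elim by (subst nn_integral_cmult) (auto simp: nn_integral_inverse_Icc)
      finally show ?case by (simp add: mult.commute)
    qed
  qed
  also have "\<dots> = ennreal (ln 2) * (\<integral>\<^sup>+x. f x \<partial>lborel)"
    by (rule nn_integral_cmult) simp
  finally show ?thesis ..
qed

section \<open>Differences along segments and the unweighted double integral over a ball\<close>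

lemma C1_grad:
  fixes v :: "real ^ 'n \<Rightarrow> real"
  assumes "C_k 1 v"
  shows "v differentiable (at x)" "continuous_on UNIV (grad v)"
  using assms unfolding grad_def by (auto intro!: continuous_intros)

lemma C1_line_derivative:
  fixes v :: "real ^ 'n \<Rightarrow> real"
  assumes "C_k 1 v"
  shows "((\<lambda>t. v (x + t *\<^sub>R w)) has_real_derivative w \<bullet> grad v (x + t *\<^sub>R w)) (at t)"
proof -
  have v: "(v has_derivative (\<lambda>h. h \<bullet> grad v (x + t *\<^sub>R w))) (at (x + t *\<^sub>R w))"
    using grad_GDERIV[OF C1_grad(1)[OF assms]] by (simp add: gderiv_def)
  have "((\<lambda>t. x + t *\<^sub>R w) has_derivative (\<lambda>t. t *\<^sub>R w)) (at t)"
    by (auto intro!: derivative_eq_intros)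
  from has_derivative_compose[OF this v] show ?thesis
    by (simp add: has_field_derivative_def mult_commute_abs)
qed

text \<open>The directional derivative \<open>g\<close> along the segment has mean
  \<open>D = v y - v x\<close>. Integrating
  \<open>2 * D * g t - D\<^sup>2 \<le> (g t)\<^sup>2\<close> bounds \<open>D\<^sup>2\<close> by the
  mean of the squares, and Cauchy-Schwarz bounds \<open>g\<close> by the gradient.\<close>

lemma sq_diff_le_segment:
  fixes v :: "real ^ 'n \<Rightarrow> real"
  assumes v: "C_k 1 v"
  shows "ennreal ((v x - v y)\<^sup>2) \<le> ennreal ((dist x y)\<^sup>2) *
    (\<integral>\<^sup>+t\<in>{0..1}. ennreal ((norm (grad v ((1 - t) *\<^sub>R x + t *\<^sub>R y)))\<^sup>2) \<partial>lborel)"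
proof -
  define g where "g = (\<lambda>t. (y - x) \<bullet> grad v (x + t *\<^sub>R (y - x)))"
  define h where "h = (\<lambda>t. (norm (grad v (x + t *\<^sub>R (y - x))))\<^sup>2)"
  define D where "D = v y - v x"
  have seg: "(1 - t) *\<^sub>R x + t *\<^sub>R y = x + t *\<^sub>R (y - x)" for t
    by (simp add: algebra_simps)
  have "(g has_integral (v (x + 1 *\<^sub>R (y - x)) - v (x + 0 *\<^sub>R (y - x)))) {0..1}"
    unfolding g_def
    by (intro fundamental_theorem_of_calculus)
       (auto intro!: has_field_derivative_at_within C1_line_derivative[OF v]
         simp flip: has_real_derivative_iff_has_vector_derivative)
  then have g: "(g has_integral D) {0..1}" by (simp add: D_def)
  have "continuous_on {0..1} h" unfolding h_def
    by (intro continuous_intros continuous_on_compose2[OF C1_grad(2)[OF v]]) auto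
  then obtain I where I: "(h has_integral I) {0..1}"
    using integrable_continuous_interval by blast
  have c: "((\<lambda>t. D\<^sup>2) has_integral D\<^sup>2) {0..1::real}"
    using has_integral_const_real[of "D\<^sup>2" 0 1] by simp
  have "2 * D * D - D\<^sup>2 \<le> (dist x y)\<^sup>2 * I"
  proof (rule has_integral_le[OF has_integral_diff[OF has_integral_mult_right[OF g] c] has_integral_mult_right[OF I]])
    fix t :: real
    have "\<bar>g t\<bar> \<le> dist x y * norm (grad v (x + t *\<^sub>R (y - x)))"
      unfolding g_def by (metis Cauchy_Schwarz_ineq2 dist_commute dist_norm)
    then have "(g t)\<^sup>2 \<le> (dist x y)\<^sup>2 * h t"
      unfolding h_def by (metis abs_ge_zero power2_abs power_mono power_mult_distrib)
    moreover have "0 \<le> (g t - D)\<^sup>2" by simp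
    ultimately show "2 * D * g t - D\<^sup>2 \<le> (dist x y)\<^sup>2 * h t"
      by (simp add: power2_eq_square algebra_simps)
  qed
  then have "(v x - v y)\<^sup>2 \<le> (dist x y)\<^sup>2 * I"
    by (simp add: D_def power2_eq_square algebra_simps)
  moreover have "(\<integral>\<^sup>+t\<in>{0..1}. ennreal (h t) \<partial>lborel) = ennreal I"
    by (rule nn_integral_has_integral_lebesgue'[OF _ I]) (simp add: h_def)
  ultimately show ?thesis
    unfolding seg by (simp add: h_def ennreal_leI flip: ennreal_mult')
qed

text \<open>By convexity the contraction towards \<open>y\<close> maps \<open>B\<close> into itself.
  It scales volume by \<open>(1 - t) ^ DIM('a)\<close>, which is at least
  \<open>(1 / 2) ^ DIM('a)\<close> for \<open>t \<le> 1 / 2\<close>.\<close>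

lemma nn_integral_contract_le:
  fixes g :: "'a::euclidean_space \<Rightarrow> ennreal"
  assumes [measurable]: "g \<in> borel_measurable borel" and B: "convex B" and [measurable]: "B \<in> sets borel"
    and y: "y \<in> B" and t: "0 \<le> t" "t \<le> 1 / 2"
  shows "(\<integral>\<^sup>+x\<in>B. g ((1 - t) *\<^sub>R x + t *\<^sub>R y) \<partial>lborel) \<le> 2 ^ DIM('a) * (\<integral>\<^sup>+x\<in>B. g x \<partial>lborel)"
proof -
  have "ennreal ((1 / 2) ^ DIM('a)) * (\<integral>\<^sup>+x\<in>B. g ((1 - t) *\<^sub>R x + t *\<^sub>R y) \<partial>lborel)
    \<le> ennreal (\<bar>1 - t\<bar> ^ DIM('a)) * (\<integral>\<^sup>+x. g (t *\<^sub>R y + (1 - t) *\<^sub>R x) * indicator B (t *\<^sub>R y + (1 - t) *\<^sub>R x) \<partial>lborel)"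
  proof (rule mult_mono[OF ennreal_leI[OF power_mono] nn_integral_mono])
    fix x
    show "g ((1 - t) *\<^sub>R x + t *\<^sub>R y) * indicator B x \<le> g (t *\<^sub>R y + (1 - t) *\<^sub>R x) * indicator B (t *\<^sub>R y + (1 - t) *\<^sub>R x)"
      using convexD[OF B y, of x t "1 - t"] t by (auto simp: indicator_def add.commute)
  qed (use t in auto)
  also have "\<dots> = (\<integral>\<^sup>+x\<in>B. g x \<partial>lborel)"
    using t by (subst nn_integral_lborel_scaleR[where c="1 - t" and t="t *\<^sub>R y"]) auto
  finally have "2 ^ DIM('a) * (ennreal ((1 / 2) ^ DIM('a)) * (\<integral>\<^sup>+x\<in>B. g ((1 - t) *\<^sub>R x + t *\<^sub>R y) \<partial>lborel))
     \<le> 2 ^ DIM('a) * (\<integral>\<^sup>+x\<in>B. g x \<partial>lborel)"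
    by (rule mult_left_mono) simp
  moreover have "2 ^ DIM('a) * ennreal ((1 / 2) ^ DIM('a)) = 1"
  proof -
    have "(2::ennreal) ^ DIM('a) = ennreal (2 ^ DIM('a))" by (simp flip: ennreal_power)
    then show ?thesis by (simp flip: ennreal_mult' add: power_one_over)
  qed
  ultimately show ?thesis by (simp add: mult.assoc[symmetric])
qed

text \<open>The segment from \<open>x\<close> to \<open>y\<close> is integrated by substituting for the endpoint that is farther
  away, so that the Jacobian stays below \<open>2 ^ n\<close>.\<close>

lemma double_integral_sq_diff_le:
  fixes v :: "real ^ 'n \<Rightarrow> real"
  assumes v: "C_k 1 v" and \<rho>: "\<rho> > 0"
  defines "B \<equiv> cball (0 :: real ^ 'n) \<rho>"
  shows "(\<integral>\<^sup>+y\<in>B. (\<integral>\<^sup>+x\<in>B. ennreal ((v x - v y)\<^sup>2) \<partial>lborel) \<partial>lborel)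
    \<le> ennreal (4 * \<rho>\<^sup>2) * (2 ^ CARD('n) * emeasure lborel B) *
       (\<integral>\<^sup>+x\<in>B. ennreal ((norm (grad v x))\<^sup>2) \<partial>lborel)"
proof -
  define g where "g = (\<lambda>x. ennreal ((norm (grad v x))\<^sup>2))"
  have [measurable]: "grad v \<in> borel_measurable borel"
    by (rule borel_measurable_continuous_onI[OF C1_grad(2)[OF v]])
  have g[measurable]: "g \<in> borel_measurable borel" unfolding g_def by measurable
  have B: "convex B" and [measurable]: "B \<in> sets borel" by (auto simp: B_def)
  let ?G = "\<integral>\<^sup>+x\<in>B. g x \<partial>lborel"
  let ?h = "\<lambda>t x y. g ((1 - t) *\<^sub>R x + t *\<^sub>R y) * indicator B x * indicator B y"
  have h: "(\<integral>\<^sup>+y. (\<integral>\<^sup>+x. ?h t x y \<partial>lborel) \<partial>lborel) \<le> 2 ^ CARD('n) * emeasure lborel B * ?G" (is "?L \<le> ?R")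
    if t: "t \<in> {0..1}" for t
  proof (cases "t \<le> 1 / 2")
    case True
    have "?L \<le> (\<integral>\<^sup>+y. 2 ^ CARD('n) * ?G * indicator B y \<partial>lborel)"
    proof (rule nn_integral_mono)
      fix y
      show "(\<integral>\<^sup>+x. ?h t x y \<partial>lborel) \<le> 2 ^ CARD('n) * ?G * indicator B y"
        using nn_integral_contract_le[OF g B _ _ _ True, of y] t by (cases "y \<in> B") auto
    qed
    also have "\<dots> = ?R" by (subst nn_integral_cmult_indicator) (auto simp: mult_ac)
    finally show ?thesis .
  next
    case False
    have "?L = (\<integral>\<^sup>+x. (\<integral>\<^sup>+y. ?h t x y \<partial>lborel) \<partial>lborel)"
      by (rule lborel_pair.Fubini') measurable
    also have "\<dots> \<le> (\<integral>\<^sup>+x. 2 ^ CARD('n) * ?G * indicator B x \<partial>lborel)"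
    proof (rule nn_integral_mono)
      fix x
      show "(\<integral>\<^sup>+y. ?h t x y \<partial>lborel) \<le> 2 ^ CARD('n) * ?G * indicator B x"
        using nn_integral_contract_le[OF g B _ _, of x "1 - t"] t False
        by (cases "x \<in> B") (auto simp: add.commute)
    qed
    also have "\<dots> = ?R" by (subst nn_integral_cmult_indicator) (auto simp: mult_ac)
    finally show ?thesis .
  qed
  have "(\<integral>\<^sup>+y\<in>B. (\<integral>\<^sup>+x\<in>B. ennreal ((v x - v y)\<^sup>2) \<partial>lborel) \<partial>lborel)
     \<le> (\<integral>\<^sup>+y. (\<integral>\<^sup>+x. ennreal (4 * \<rho>\<^sup>2) * (\<integral>\<^sup>+t. ?h t x y * indicator {0..1} t \<partial>lborel) \<partial>lborel) \<partial>lborel)"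
  proof (rule nn_integral_mono)
    fix y
    have *: "ennreal ((v x - v y)\<^sup>2) \<le> ennreal (4 * \<rho>\<^sup>2) * (\<integral>\<^sup>+t. ?h t x y * indicator {0..1} t \<partial>lborel)"
      if "x \<in> B" "y \<in> B" for x
    proof -
      have "dist x y \<le> 2 * \<rho>"
        using that dist_triangle[of x y 0] unfolding B_def by (auto simp: dist_commute)
      then have "(dist x y)\<^sup>2 \<le> (2 * \<rho>)\<^sup>2" by (intro power_mono) auto
      then have "(dist x y)\<^sup>2 \<le> 4 * \<rho>\<^sup>2" by (simp add: power_mult_distrib)
      then have "ennreal ((v x - v y)\<^sup>2) \<le> ennreal (4 * \<rho>\<^sup>2) * (\<integral>\<^sup>+t\<in>{0..1}. g ((1 - t) *\<^sub>R x + t *\<^sub>R y) \<partial>lborel)"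
        using sq_diff_le_segment[OF v, of x y] unfolding g_def
        by (meson ennreal_leI mult_right_mono order_trans zero_le)
      with that show ?thesis by simp
    qed
    show "(\<integral>\<^sup>+x\<in>B. ennreal ((v x - v y)\<^sup>2) \<partial>lborel) * indicator B y
      \<le> (\<integral>\<^sup>+x. ennreal (4 * \<rho>\<^sup>2) * (\<integral>\<^sup>+t. ?h t x y * indicator {0..1} t \<partial>lborel) \<partial>lborel)"
      using * by (cases "y \<in> B") (auto intro!: nn_integral_mono simp: indicator_def)
  qed
  \<comment> \<open>The integral over \<open>t\<close> is moved outermost, because which endpoint is
    substituted in \<open>h\<close> depends on \<open>t\<close>.\<close>
  also have "\<dots> = ennreal (4 * \<rho>\<^sup>2) * (\<integral>\<^sup>+y. (\<integral>\<^sup>+x. (\<integral>\<^sup>+t. ?h t x y * indicator {0..1} t \<partial>lborel) \<partial>lborel) \<partial>lborel)"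
    by (subst nn_integral_cmult, measurable)+
  also have "(\<integral>\<^sup>+y. (\<integral>\<^sup>+x. (\<integral>\<^sup>+t. ?h t x y * indicator {0..1} t \<partial>lborel) \<partial>lborel) \<partial>lborel)
     = (\<integral>\<^sup>+y. (\<integral>\<^sup>+t. (\<integral>\<^sup>+x. ?h t x y * indicator {0..1} t \<partial>lborel) \<partial>lborel) \<partial>lborel)"
    by (intro nn_integral_cong lborel_pair.Fubini') measurable
  also have "\<dots> = (\<integral>\<^sup>+t. (\<integral>\<^sup>+y. (\<integral>\<^sup>+x. ?h t x y * indicator {0..1} t \<partial>lborel) \<partial>lborel) \<partial>lborel)"
    by (rule lborel_pair.Fubini') measurable
  also have "\<dots> = (\<integral>\<^sup>+t. (\<integral>\<^sup>+y. (\<integral>\<^sup>+x. ?h t x y \<partial>lborel) \<partial>lborel) * indicator {0..1} t \<partial>lborel)"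
    by (intro nn_integral_cong) (auto simp: indicator_def)
  also have "\<dots> \<le> (\<integral>\<^sup>+t. 2 ^ CARD('n) * emeasure lborel B * ?G * indicator {0..1::real} t \<partial>lborel)"
    by (intro nn_integral_mono) (use h in \<open>auto simp: indicator_def\<close>)
  also have "\<dots> = 2 ^ CARD('n) * emeasure lborel B * ?G"
    by (subst nn_integral_cmult_indicator) auto
  finally show ?thesis
    by (simp add: g_def mult.assoc mult_left_mono)
qed

section \<open>From rays to the whole space, and comparison of weights on a ball\<close>

lemma grad_le_of_line:
  assumes "norm w = 1" shows "(w \<bullet> g)\<^sup>2 \<le> (norm g)\<^sup>2"
  using Cauchy_Schwarz_ineq2[of w g] abs_le_square_iff[of "w \<bullet> g" "norm g"] assms by simp

text \<open>The one-dimensional estimate is applied on every ray with the common constant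
  \<open>c\<close> and integrated over the directions; the radial derivative is bounded by the full
  gradient. The remainder lives on a shell but is enlarged to the ball, whose convexity the segment
  argument needs.\<close>

lemma weighted_sq_le_ball_remainder:
  fixes b \<mu> \<alpha> \<delta> :: real
  defines "m \<equiv> real CARD('n::finite) - 1 - b" and "m' \<equiv> real CARD('n) - 1 - \<mu>"
  assumes m: "m > -1" and \<alpha>: "\<alpha> > 0" and \<delta>: "\<delta> > 0"
    and m'_le: "m' \<le> m + 2" and m'_ge: "m + 2 - 2 * \<alpha> \<le> m'"
  obtains R K where "R > 0" "K > 0"
    "\<And>(v :: real ^ 'n \<Rightarrow> real) c. C_k 1 v \<Longrightarrow>
      (\<integral>\<^sup>+ y. ennreal (\<bar>v y - c\<bar>\<^sup>2 / norm y powr b * exp (- \<delta> * norm y powr \<alpha>)) \<partial>lborel)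
      \<le> ennreal K * ((\<integral>\<^sup>+ y. ennreal ((norm (grad v y))\<^sup>2 / norm y powr \<mu> * exp (- \<delta> * norm y powr \<alpha>)) \<partial>lborel)
         + (\<integral>\<^sup>+ y\<in>cball 0 R. ennreal ((v y - c)\<^sup>2) \<partial>lborel))"
proof (rule radial_sq_le[OF m \<alpha> \<delta> m'_le m'_ge])
  let ?n = "CARD('n)"
  fix R K
  assume R: "R \<ge> 1" and K: "K > 0" and le: "\<And>\<phi> \<phi>' c k. (\<And>r. r > 0 \<Longrightarrow> (\<phi> has_real_derivative \<phi>' r) (at r)) \<Longrightarrow>
       continuous_on UNIV \<phi> \<Longrightarrow> continuous_on UNIV \<phi>' \<Longrightarrow>
       (\<integral>\<^sup>+r\<in>{0<..}. ennreal ((\<phi> r - c)\<^sup>2 * radial_wt \<alpha> \<delta> m r) \<partial>lborel)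
        \<le> ennreal K * ((\<integral>\<^sup>+r\<in>{0<..}. ennreal ((\<phi>' r)\<^sup>2 * radial_wt \<alpha> \<delta> m' r) \<partial>lborel)
          + (\<integral>\<^sup>+r\<in>{R..2 * R}. ennreal ((\<phi> r - c)\<^sup>2 * r ^ k) \<partial>lborel))"
  show thesis
  proof (rule that[of "2 * R" K])
    fix v :: "real ^ 'n \<Rightarrow> real" and c
    assume v: "C_k 1 v"
    define f where "f = (\<lambda>y. ennreal (\<bar>v y - c\<bar>\<^sup>2 / norm y powr b * exp (- \<delta> * norm y powr \<alpha>)))"
    define g where "g = (\<lambda>y. ennreal ((norm (grad v y))\<^sup>2 / norm y powr \<mu> * exp (- \<delta> * norm y powr \<alpha>)))"
    define h where "h = (\<lambda>y. ennreal ((v y - c)\<^sup>2) * indicator (cball 0 (2 * R)) y)"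
    have cv: "continuous_on UNIV v"
      using C1_grad(1)[OF v] by (intro differentiable_imp_continuous_on) (auto simp: differentiable_on_def)
    have [measurable]: "v \<in> borel_measurable borel" "grad v \<in> borel_measurable borel"
      using cv C1_grad(2)[OF v] by (auto intro: borel_measurable_continuous_onI)
    have [measurable]: "cball 0 (2 * R) \<in> sets (borel :: (real ^ 'n) measure)" by simp
    have [measurable]: "f \<in> borel_measurable borel" "g \<in> borel_measurable borel" "h \<in> borel_measurable borel"
      unfolding f_def g_def h_def by measurable
    have rpow: "r ^ (?n - 1) = r powr (real ?n - 1)" if "r > 0" for r :: real
      using that by (subst powr_realpow[symmetric]) (auto simp: of_nat_diff Suc_leI)
    have ray: "(\<integral>\<^sup>+r\<in>{0<..}. f (r *\<^sub>R w) * ennreal (r ^ (?n - 1)) \<partial>lborel)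
       \<le> ennreal K * (\<integral>\<^sup>+r\<in>{0<..}. (g (r *\<^sub>R w) + h (r *\<^sub>R w)) * ennreal (r ^ (?n - 1)) \<partial>lborel)"
      if w: "norm w = 1" for w
    proof -
      define \<phi> where "\<phi> = (\<lambda>r. v (r *\<^sub>R w))"
      define \<phi>' where "\<phi>' = (\<lambda>r. w \<bullet> grad v (r *\<^sub>R w))"
      have d: "(\<phi> has_real_derivative \<phi>' r) (at r)" for r
        using C1_line_derivative[OF v, of 0 w r] by (simp add: \<phi>_def \<phi>'_def)
      have c: "continuous_on UNIV \<phi>" "continuous_on UNIV \<phi>'"
        unfolding \<phi>_def \<phi>'_def
        by (intro continuous_intros continuous_on_compose2[OF cv] continuous_on_compose2[OF C1_grad(2)[OF v]]; auto)+
      have "(\<integral>\<^sup>+r\<in>{0<..}. f (r *\<^sub>R w) * ennreal (r ^ (?n - 1)) \<partial>lborel)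
         = (\<integral>\<^sup>+r\<in>{0<..}. ennreal ((\<phi> r - c)\<^sup>2 * radial_wt \<alpha> \<delta> m r) \<partial>lborel)"
        using w by (intro nn_integral_cong)
          (auto simp: f_def \<phi>_def radial_wt_def rpow[unfolded One_nat_def] m_def powr_diff ennreal_mult'[symmetric] split: split_indicator)
      also have "\<dots> \<le> ennreal K * ((\<integral>\<^sup>+r\<in>{0<..}. ennreal ((\<phi>' r)\<^sup>2 * radial_wt \<alpha> \<delta> m' r) \<partial>lborel)
          + (\<integral>\<^sup>+r\<in>{R..2 * R}. ennreal ((\<phi> r - c)\<^sup>2 * r ^ (?n - 1)) \<partial>lborel))"
        by (rule le[OF d c])
      also have "\<dots> \<le> ennreal K * ((\<integral>\<^sup>+r\<in>{0<..}. g (r *\<^sub>R w) * ennreal (r ^ (?n - 1)) \<partial>lborel)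
          + (\<integral>\<^sup>+r\<in>{0<..}. h (r *\<^sub>R w) * ennreal (r ^ (?n - 1)) \<partial>lborel))"
      proof (intro mult_left_mono[OF add_mono[OF nn_integral_mono nn_integral_mono]])
        fix r :: real
        have "ennreal ((\<phi>' r)\<^sup>2 * radial_wt \<alpha> \<delta> m' r) \<le> g (r *\<^sub>R w) * ennreal (r ^ (?n - 1))" if r: "r > 0"
        proof -
          have "(\<phi>' r)\<^sup>2 * radial_wt \<alpha> \<delta> m' r \<le> (norm (grad v (r *\<^sub>R w)))\<^sup>2 * radial_wt \<alpha> \<delta> m' r"
            unfolding \<phi>'_def by (intro mult_right_mono grad_le_of_line[OF w]) (simp add: radial_wt_def)
          also have "ennreal \<dots> = g (r *\<^sub>R w) * ennreal (r ^ (?n - 1))"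
            using r w by (simp add: g_def radial_wt_def rpow[unfolded One_nat_def] m'_def powr_diff mult_ac flip: ennreal_mult')
          finally show ?thesis using ennreal_leI by blast
        qed
        then show "ennreal ((\<phi>' r)\<^sup>2 * radial_wt \<alpha> \<delta> m' r) * indicator {0<..} r \<le> g (r *\<^sub>R w) * ennreal (r ^ (?n - 1)) * indicator {0<..} r"
          by (auto split: split_indicator)
        show "ennreal ((\<phi> r - c)\<^sup>2 * r ^ (?n - 1)) * indicator {R..2 * R} r \<le> h (r *\<^sub>R w) * ennreal (r ^ (?n - 1)) * indicator {0<..} r"
          using w R by (auto simp: h_def \<phi>_def ennreal_mult' split: split_indicator)
      qed simp
      also have "\<dots> = ennreal K * (\<integral>\<^sup>+r. g (r *\<^sub>R w) * ennreal (r ^ (?n - 1)) * indicator {0<..} r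
          + h (r *\<^sub>R w) * ennreal (r ^ (?n - 1)) * indicator {0<..} r \<partial>lborel)"
        by (subst nn_integral_add) auto
      finally show ?thesis by (simp add: distrib_right)
    qed
    \<comment> \<open>Writing both sides in polar form reduces the claim to \<open>ray\<close> for
      each direction \<open>sgn x\<close>. The common factor \<open>ln 2\<close> cancels
      afterwards.\<close>
    have "ennreal (ln 2) * (\<integral>\<^sup>+y. f y \<partial>lborel)
       \<le> ennreal (ln 2) * (\<integral>\<^sup>+y. ennreal K * (g y + h y) \<partial>lborel)"
    proof (subst (1 2) nn_integral_polar, measurable, rule nn_integral_mono)
      fix x :: "real ^ 'n"
      let ?A = "{x :: real ^ 'n. 1 \<le> norm x \<and> norm x \<le> 2}"
      have *: "(\<integral>\<^sup>+r\<in>{0<..}. f (r *\<^sub>R sgn x) * ennreal (r ^ (?n - 1)) \<partial>lborel)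
        \<le> (\<integral>\<^sup>+r\<in>{0<..}. (ennreal K * (g (r *\<^sub>R sgn x) + h (r *\<^sub>R sgn x))) * ennreal (r ^ (?n - 1)) \<partial>lborel)" if "x \<in> ?A"
      proof -
        have "norm (sgn x) = 1" using that by (auto simp: norm_sgn)
        from ray[OF this] show ?thesis
          by (subst (asm) nn_integral_cmult[symmetric]) (auto simp: mult.assoc)
      qed
      show "ennreal (1 / norm x ^ DIM(real ^ 'n)) * (\<integral>\<^sup>+r\<in>{0<..}. f (r *\<^sub>R sgn x) * ennreal (r ^ (DIM(real ^ 'n) - 1)) \<partial>lborel) * indicator ?A x
        \<le> ennreal (1 / norm x ^ DIM(real ^ 'n)) * (\<integral>\<^sup>+r\<in>{0<..}. (ennreal K * (g (r *\<^sub>R sgn x) + h (r *\<^sub>R sgn x))) * ennreal (r ^ (DIM(real ^ 'n) - 1)) \<partial>lborel) * indicator ?A x"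
        using * by (cases "x \<in> ?A") (auto intro!: mult_left_mono)
    qed
    then have "(\<integral>\<^sup>+y. f y \<partial>lborel) \<le> (\<integral>\<^sup>+y. ennreal K * (g y + h y) \<partial>lborel)"
      by (subst (asm) ennreal_mult_le_mult_iff) auto
    also have "\<dots> = ennreal K * ((\<integral>\<^sup>+y. g y \<partial>lborel) + (\<integral>\<^sup>+y. h y \<partial>lborel))"
      by (simp add: nn_integral_cmult nn_integral_add)
    finally show "(\<integral>\<^sup>+ y. ennreal (\<bar>v y - c\<bar>\<^sup>2 / norm y powr b * exp (- \<delta> * norm y powr \<alpha>)) \<partial>lborel)
      \<le> ennreal K * ((\<integral>\<^sup>+ y. ennreal ((norm (grad v y))\<^sup>2 / norm y powr \<mu> * exp (- \<delta> * norm y powr \<alpha>)) \<partial>lborel)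
         + (\<integral>\<^sup>+ y\<in>cball 0 (2 * R). ennreal ((v y - c)\<^sup>2) \<partial>lborel))"
      unfolding f_def g_def h_def .
  qed (use R K in auto)
qed

text \<open>On the punctured ball the gradient weight is bounded below by its value at radius
  \<open>\<rho>\<close>, since \<open>\<mu>\<close>, \<open>\<delta>\<close> and
  \<open>\<alpha>\<close> are nonnegative.\<close>

lemma ball_integral_le_weighted:
  fixes h :: "'a::euclidean_space \<Rightarrow> real"
  assumes "\<And>y. 0 \<le> h y" and "\<delta> \<ge> 0" "\<mu> \<ge> 0" "\<alpha> \<ge> 0"
    and h[measurable]: "h \<in> borel_measurable borel"
  shows "(\<integral>\<^sup>+y\<in>cball 0 \<rho>. ennreal (h y) \<partial>lborel) \<le> ennreal (\<rho> powr \<mu> * exp (\<delta> * \<rho> powr \<alpha>)) *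
    (\<integral>\<^sup>+y. ennreal (h y / norm y powr \<mu> * exp (- \<delta> * norm y powr \<alpha>)) \<partial>lborel)"
proof -
  let ?E = "\<rho> powr \<mu> * exp (\<delta> * \<rho> powr \<alpha>)"
  \<comment> \<open>The pointwise bound is claimed only almost everywhere: at the origin
    \<open>norm y powr \<mu>\<close> is 0, and division by it yields 0 on the right.\<close>
  have "(\<integral>\<^sup>+y\<in>cball 0 \<rho>. ennreal (h y) \<partial>lborel)
     \<le> (\<integral>\<^sup>+y. ennreal ?E * ennreal (h y / norm y powr \<mu> * exp (- \<delta> * norm y powr \<alpha>)) \<partial>lborel)"
  proof (rule nn_integral_mono_AE)
    show "AE y in lborel. ennreal (h y) * indicator (cball 0 \<rho>) y
        \<le> ennreal ?E * ennreal (h y / norm y powr \<mu> * exp (- \<delta> * norm y powr \<alpha>))"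
      using AE_lborel_singleton[of "0::'a"]
    proof eventually_elim
      case (elim y)
      have "h y \<le> ?E * (h y / norm y powr \<mu> * exp (- \<delta> * norm y powr \<alpha>))" if y: "norm y \<le> \<rho>"
      proof -
        have "norm y powr \<mu> * exp (\<delta> * norm y powr \<alpha>) \<le> ?E"
          using y assms by (intro mult_mono powr_mono2) (auto intro!: mult_left_mono powr_mono2)
        then have "norm y powr \<mu> * exp (\<delta> * norm y powr \<alpha>) * (h y / norm y powr \<mu> * exp (- \<delta> * norm y powr \<alpha>))
          \<le> ?E * (h y / norm y powr \<mu> * exp (- \<delta> * norm y powr \<alpha>))"
          using assms by (intro mult_right_mono) auto
        then show ?thesis using elim by (simp add: exp_minus field_simps)
      qed
      then show ?case
        using assms by (auto simp: ennreal_leI split: split_indicator simp flip: ennreal_mult')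
    qed
  qed
  also have "\<dots> = ennreal ?E * (\<integral>\<^sup>+y. ennreal (h y / norm y powr \<mu> * exp (- \<delta> * norm y powr \<alpha>)) \<partial>lborel)"
    by (rule nn_integral_cmult) simp
  finally show ?thesis .
qed

section \<open>Matching the exponents and averaging over the constant\<close>

theorem lemma3p6:
  fixes N :: nat and \<delta> \<mu> \<alpha> :: real
  assumes "N > 0" and "CARD('n::finite) = N"
    and "\<delta> > 0"
    and "0 \<le> \<mu>" and "\<mu> < real N - 2"
    and "\<alpha> \<ge> (real N - 2 - \<mu>) / (real N - 2)"
  shows "\<exists>C::real. C > 0 \<and> (\<forall>v :: real ^ 'n \<Rightarrow> real. smooth v \<longrightarrow>
    (\<integral>\<^sup>+ y. ennreal ((norm (grad v y))\<^sup>2 / norm y powr \<mu> * exp (- \<delta> * norm y powr \<alpha>)) \<partial>lborel)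
    \<ge> ennreal C * (INF c::real. \<integral>\<^sup>+ y. ennreal (\<bar>v y - c\<bar>\<^sup>2 / norm y powr (real N * \<mu> / (real N - 2))
                     * exp (- \<delta> * norm y powr \<alpha>)) \<partial>lborel))"
proof -
  define b where "b = real N * \<mu> / (real N - 2)"
  \<comment> \<open>In terms of \<open>\<theta>\<close> the data become linear:
    \<open>\<mu> = \<theta> * (real N - 2)\<close>, \<open>b = real N * \<theta>\<close>,
    \<open>\<theta> < 1\<close> and \<open>\<alpha> \<ge> 1 - \<theta>\<close>.\<close>
  define \<theta> where "\<theta> = \<mu> / (real N - 2)"
  have N2: "real N - 2 > 0" using assms by linarith
  have \<theta>: "\<theta> < 1" using assms N2 by (simp add: \<theta>_def)
  have \<mu>: "\<mu> = \<theta> * (real N - 2)" using N2 by (simp add: \<theta>_def)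
  have b: "b = real N * \<theta>" by (simp add: b_def \<theta>_def)
  have \<alpha>: "\<alpha> \<ge> 1 - \<theta>" using assms N2 by (simp add: \<theta>_def diff_divide_distrib)
  have \<alpha>0: "\<alpha> > 0" using \<alpha> \<theta> by simp
  \<comment> \<open>This makes the singularity \<open>norm y powr (- b)\<close> integrable at the
    origin.\<close>
  have "real N * \<theta> < real N" using \<theta> assms(1) by simp
  then have m: "real CARD('n) - 1 - b > -1" using assms(2) b by simp
  \<comment> \<open>The two radial exponents differ by \<open>b - \<mu> = 2 * \<theta>\<close>.
    Hence the condition near the origin amounts to \<open>\<theta> \<le> 1\<close> and the one at
    infinity to \<open>\<alpha> \<ge> 1 - \<theta>\<close>.\<close>
  have m'_le: "real CARD('n) - 1 - \<mu> \<le> real CARD('n) - 1 - b + 2"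
    and m'_ge: "real CARD('n) - 1 - b + 2 - 2 * \<alpha> \<le> real CARD('n) - 1 - \<mu>"
    using \<alpha> \<theta> by (simp_all add: b \<mu> algebra_simps)
  obtain R K where R: "R > 0" and K: "K > 0" and
    le: "\<And>(v :: real ^ 'n \<Rightarrow> real) c. C_k 1 v \<Longrightarrow>
      (\<integral>\<^sup>+ y. ennreal (\<bar>v y - c\<bar>\<^sup>2 / norm y powr b * exp (- \<delta> * norm y powr \<alpha>)) \<partial>lborel)
      \<le> ennreal K * ((\<integral>\<^sup>+ y. ennreal ((norm (grad v y))\<^sup>2 / norm y powr \<mu> * exp (- \<delta> * norm y powr \<alpha>)) \<partial>lborel)
         + (\<integral>\<^sup>+ y\<in>cball 0 R. ennreal ((v y - c)\<^sup>2) \<partial>lborel))"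
    by (rule weighted_sq_le_ball_remainder[OF m \<alpha>0 assms(3) m'_le m'_ge]) (rule that)
  let ?B = "cball (0 :: real ^ 'n) R"
  \<comment> \<open>The constant of the double integral, without the volume of the ball, times the
    factor for passing to the weighted gradient integral. The volume is kept apart because it
    cancels at the end.\<close>
  define L where "L = 4 * R\<^sup>2 * 2 ^ CARD('n) * (R powr \<mu> * exp (\<delta> * R powr \<alpha>))"
  have L: "L \<ge> 0" by (simp add: L_def)
  define E where "E = K * (1 + L)"
  have E: "E > 0" using K L by (simp add: E_def)
  show ?thesis
  proof (intro exI[of _ "1 / E"] conjI allI impI)
    show "1 / E > 0" using E by simp
    fix v :: "real ^ 'n \<Rightarrow> real"
    assume "smooth v"
    then have v: "C_k 1 v" by (simp add: smooth_def)
    have cv: "continuous_on UNIV v"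
      using C1_grad(1)[OF v] by (intro differentiable_imp_continuous_on) (auto simp: differentiable_on_def)
    have [measurable]: "v \<in> borel_measurable borel" "grad v \<in> borel_measurable borel"
      using cv C1_grad(2)[OF v] by (auto intro: borel_measurable_continuous_onI)
    define D where "D = (\<integral>\<^sup>+ y. ennreal ((norm (grad v y))\<^sup>2 / norm y powr \<mu> * exp (- \<delta> * norm y powr \<alpha>)) \<partial>lborel)"
    define J where "J = (\<lambda>c. \<integral>\<^sup>+ y. ennreal (\<bar>v y - c\<bar>\<^sup>2 / norm y powr b * exp (- \<delta> * norm y powr \<alpha>)) \<partial>lborel)"
    define S where "S = (\<lambda>y. \<integral>\<^sup>+ x\<in>?B. ennreal ((v x - v y)\<^sup>2) \<partial>lborel)"
    define \<beta> where "\<beta> = emeasure lborel ?B"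
    have [measurable]: "?B \<in> sets borel" by simp
    have [measurable]: "S \<in> borel_measurable borel" unfolding S_def by measurable
    have "(\<integral>\<^sup>+y\<in>?B. S y \<partial>lborel) \<le> ennreal (4 * R\<^sup>2) * (2 ^ CARD('n) * \<beta>) *
       (\<integral>\<^sup>+x\<in>?B. ennreal ((norm (grad v x))\<^sup>2) \<partial>lborel)"
      unfolding S_def \<beta>_def by (rule double_integral_sq_diff_le[OF v R])
    also have "\<dots> \<le> ennreal (4 * R\<^sup>2) * (2 ^ CARD('n) * \<beta>) * (ennreal (R powr \<mu> * exp (\<delta> * R powr \<alpha>)) * D)"
      unfolding D_def using assms \<alpha>0 by (intro mult_left_mono ball_integral_le_weighted) auto
    also have "\<dots> = ennreal L * D * \<beta>"
    proof -
      have "(2::ennreal) ^ CARD('n) = ennreal (2 ^ CARD('n))" by (simp flip: ennreal_power)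
      then show ?thesis by (simp add: L_def ennreal_mult' mult_ac)
    qed
    finally have S: "(\<integral>\<^sup>+y\<in>?B. S y \<partial>lborel) \<le> ennreal L * D * \<beta>" .
    \<comment> \<open>For each \<open>y\<close> in the ball \<open>v y\<close> is an admissible
      constant, so the infimum is at most \<open>J (v y)\<close>. Integrating over \<open>y\<close>
      turns the remainder into the double integral bounded by \<open>S\<close>.\<close>
    have "(INF c. J c) * \<beta> = (\<integral>\<^sup>+y\<in>?B. (INF c. J c) \<partial>lborel)"
      by (simp add: nn_integral_cmult_indicator \<beta>_def)
    also have "\<dots> \<le> (\<integral>\<^sup>+y. ennreal K * (D * indicator ?B y + S y * indicator ?B y) \<partial>lborel)"
    proof (rule nn_integral_mono)
      fix y
      have "(INF c. J c) \<le> J (v y)" by (rule INF_lower) simp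
      also have "\<dots> \<le> ennreal K * (D + S y)" unfolding J_def D_def S_def by (rule le[OF v])
      finally show "(INF c. J c) * indicator ?B y \<le> ennreal K * (D * indicator ?B y + S y * indicator ?B y)"
        by (simp split: split_indicator)
    qed
    also have "\<dots> = ennreal K * (D * \<beta> + (\<integral>\<^sup>+y\<in>?B. S y \<partial>lborel))"
      by (simp add: nn_integral_cmult nn_integral_add nn_integral_cmult_indicator \<beta>_def)
    also have "\<dots> \<le> ennreal K * (D * \<beta> + ennreal L * D * \<beta>)"
      by (intro mult_left_mono add_left_mono S) simp
    also have "\<dots> = ennreal E * D * \<beta>"
      using K L by (simp add: E_def ennreal_mult' ennreal_plus algebra_simps)
    finally have "\<beta> * (INF c. J c) \<le> \<beta> * (ennreal E * D)" by (simp add: mult_ac)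
    \<comment> \<open>The ball has positive finite volume, so \<open>\<beta>\<close> may be
      cancelled in the extended nonnegative reals.\<close>
    moreover have "unit_ball_vol (real CARD('n)) \<noteq> 0"
      using unit_ball_vol_pos[of "real CARD('n)"] by linarith
    then have "\<beta> \<noteq> 0" "\<beta> \<noteq> top"
      using R by (simp_all add: \<beta>_def emeasure_cball)
    ultimately have "(INF c. J c) \<le> ennreal E * D" by (simp add: ennreal_mult_le_mult_iff)
    then have "ennreal (1 / E) * (INF c. J c) \<le> ennreal (1 / E) * (ennreal E * D)"
      by (rule mult_left_mono) simp
    also have "\<dots> = D"
    proof -
      have "ennreal (1 / E) * ennreal E = 1" using E by (subst ennreal_mult'[symmetric]) auto
      then show ?thesis by (simp add: mult.assoc[symmetric])
    qed
    finally show "ennreal (1 / E) * (INF c. \<integral>\<^sup>+ y. ennreal (\<bar>v y - c\<bar>\<^sup>2 / norm y powr (real N * \<mu> / (real N - 2))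
                     * exp (- \<delta> * norm y powr \<alpha>)) \<partial>lborel)
      \<le> (\<integral>\<^sup>+ y. ennreal ((norm (grad v y))\<^sup>2 / norm y powr \<mu> * exp (- \<delta> * norm y powr \<alpha>)) \<partial>lborel)"
      unfolding D_def J_def b_def .
  qed
qed

end
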